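(* Assume that the metric measure space $X=(X,d,\mu)$ is complete and separable, and that $U\subset X$ is a coanalytic set. For every Borel function $\rho:X\to[0,\infty]$ define $$u_\rho(x)=\inf_{\gamma\in\Gamma_x}\int_\gamma\rho\,ds,\qquad x\in X,$$ where $\Gamma_x$ is the family of all rectifiable curves $\gamma:[0,l_\gamma]\to X$ (including constant curves) such that $\gamma(0)=x$ and $\gamma(l_\gamma)\in X\setminus U$. Then $u_\rho$ is measurable.
   Context: $X=(X,d,\mu)$ is a metric space with metric $d$ and a positive complete Borel measure $\mu$ such that $\mu(B)<\infty$ for all open balls $B\subset X$. "Measurable" means $\mu$-measurable. A curve is a continuous mapping from a compact interval; a rectifiable curve $\gamma$ has finite length $l_\gamma$ and is parameterized by arc length $ds$ on $[0,l_\gamma]$. For a constant curve $l_\gamma=0$ and $\int_\gamma\rho\,ds=0$. The infimum over the empty family is $\infty$. A subset of a complete separable metric space is analytic (Suslin) if it is a continuous image of a complete separable metric space (the empty set is analytic). A set $U\subset X$ is coanalytic if $X\setminus U$ is analytic. *)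

theory Defs
  imports "HOL-Analysis.Analysis"
begin

text \<open>
  HOL cannot quantify over types inside a formula, so the complete separable metric space in the
  definition is carried by a set of reals.  A separable metric space has at most the cardinality
  of the continuum, so this is no restriction: see \<open>analytic_set_image\<close>.  Carriers may be empty,
  hence the empty set is analytic.
\<close>

definition analytic_set :: "'a::polish_space set \<Rightarrow> bool" where
  "analytic_set A \<longleftrightarrow>
     (\<exists>(m :: real metric) f. mcomplete_of m \<and> separable_space (mtopology_of m) \<and>
        continuous_map (mtopology_of m) euclidean f \<and> A = f ` mspace m)"

definition coanalytic_set :: "'a::polish_space set \<Rightarrow> bool" where
  "coanalytic_set U \<longleftrightarrow> analytic_set (- U)"

lemma separable_metric_lepoll_reals:
  fixes m :: "'b metric"
  assumes "separable_space (mtopology_of m)"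
  shows "mspace m \<lesssim> (UNIV :: real set)"
proof -
  interpret Metric_space "mspace m" "mdist m" by simp
  obtain C where C: "countable C" "C \<subseteq> mspace m" "mtopology closure_of C = mspace m"
    using assms by (auto simp: separable_space_def mtopology_of_def)
  define g where "g = (\<lambda>x. {(n, k). n \<in> to_nat_on C ` C \<and>
                        mdist m x (from_nat_into C n) < inverse (real (Suc k))})"
  have "inj_on g (mspace m)"
  proof (rule inj_onI, rule ccontr)
    fix x y assume xy: "x \<in> mspace m" "y \<in> mspace m" "g x = g y" "x \<noteq> y"
    then have "mdist m x y > 0" by simp
    then obtain k where k: "inverse (real (Suc k)) < mdist m x y / 2"
      using reals_Archimedean[of "mdist m x y / 2"] by auto
    have "x \<in> mtopology closure_of C" using C xy by simp
    then obtain c where c: "c \<in> C" "mdist m x c < inverse (real (Suc k))"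
      unfolding metric_closure_of
      by (smt (verit, best) in_mball inverse_positive_iff_positive mem_Collect_eq
            of_nat_0_less_iff zero_less_Suc)
    then have "(to_nat_on C c, k) \<in> g x" using C(1) by (auto simp: g_def)
    then have "(to_nat_on C c, k) \<in> g y" using xy by simp
    then have "mdist m y c < inverse (real (Suc k))" using C(1) c by (auto simp: g_def)
    moreover have "mdist m x y \<le> mdist m x c + mdist m y c"
      using C(2) c xy by (metis mdist_commute mdist_triangle subsetD)
    ultimately show False using c k by linarith
  qed
  then have "inj_on ((`) prod_encode \<circ> g) (mspace m)"
    by (auto simp: inj_on_def inj_image_eq_iff[OF inj_prod_encode])
  then have "mspace m \<lesssim> (UNIV :: nat set set)"
    unfolding lepoll_def by blast
  then show ?thesis
    using nat_sets_eqpoll_reals by (rule lepoll_trans2)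
qed

lemma analytic_set_image:
  fixes m :: "'b metric" and f :: "'b \<Rightarrow> 'a::polish_space"
  assumes m: "mcomplete_of m" "separable_space (mtopology_of m)"
    and f: "continuous_map (mtopology_of m) euclidean f"
  shows "analytic_set (f ` mspace m)"
proof -
  obtain g :: "'b \<Rightarrow> real" where g: "inj_on g (mspace m)"
    using separable_metric_lepoll_reals[OF m(2)] by (auto simp: lepoll_def)
  define h where "h = inv_into (mspace m) g"
  define T where "T = pullback_topology (g ` mspace m) h (mtopology_of m)"
  have h: "h (g x) = x" if "x \<in> mspace m" for x
    using g that by (simp add: h_def)
  have topT: "topspace T = g ` mspace m"
    by (auto simp: T_def topspace_pullback_topology h)
  have ch: "continuous_map T (mtopology_of m) h"
    using continuous_map_pullback[OF continuous_map_id] by (simp add: T_def)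
  have cg: "continuous_map (mtopology_of m) T g"
    unfolding T_def
  proof (rule continuous_map_pullback')
    show "continuous_map (mtopology_of m) (mtopology_of m) (h \<circ> g)"
      by (rule continuous_map_eq[OF continuous_map_id]) (simp add: h)
  qed auto
  have hom: "T homeomorphic_space mtopology_of m"
    unfolding homeomorphic_space_def homeomorphic_maps_def
    using ch cg h topT by (intro exI[of _ h] exI[of _ g]) auto
  have "completely_metrizable_space (mtopology_of m)"
    using m(1) Metric_space_mspace_mdist[of m]
    unfolding completely_metrizable_space_def mtopology_of_def mcomplete_of_def by blast
  then have "completely_metrizable_space T"
    using hom homeomorphic_completely_metrizable_space by blast
  then obtain M d where M: "Metric_space M d" "Metric_space.mcomplete M d"
    "T = Metric_space.mtopology M d"
    unfolding completely_metrizable_space_def by auto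
  have eqs: "mcomplete_of (metric (M, d))" "mtopology_of (metric (M, d)) = T"
    using M by (auto simp: Metric_space.mcomplete_of Metric_space.mtopology_of)
  have "separable_space T"
    using hom homeomorphic_separable_space m(2) by blast
  moreover have "continuous_map T euclidean (f \<circ> h)"
    using ch f continuous_map_compose by blast
  moreover have "f ` mspace m = (f \<circ> h) ` mspace (metric (M, d))"
  proof -
    have "mspace (metric (M, d)) = g ` mspace m"
      using topT eqs(2) topspace_mtopology_of[of "metric (M, d)"] by simp
    then show ?thesis using h by (simp add: image_image)
  qed
  ultimately show ?thesis
    unfolding analytic_set_def using eqs
    by (intro exI[of _ "metric (M, d)"] exI[of _ "f \<circ> h"]) simp
qed

text \<open>A curve is a function on the reals of which only the values on a compact interval matter.\<close>

definition is_curve :: "real \<Rightarrow> real \<Rightarrow> (real \<Rightarrow> 'a::metric_space) \<Rightarrow> bool" where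
  "is_curve a b \<gamma> \<longleftrightarrow> a \<le> b \<and> continuous_on {a..b} \<gamma>"

definition curve_length :: "real \<Rightarrow> real \<Rightarrow> (real \<Rightarrow> 'a::metric_space) \<Rightarrow> ennreal" where
  "curve_length a b \<gamma> =
     (SUP (n, t) \<in> {(n :: nat, t). t 0 = a \<and> t n = b \<and> (\<forall>i<n. t i \<le> t (Suc i))}.
        \<Sum>i<n. ennreal (dist (\<gamma> (t i)) (\<gamma> (t (Suc i)))))"

definition rectifiable_curve :: "real \<Rightarrow> real \<Rightarrow> (real \<Rightarrow> 'a::metric_space) \<Rightarrow> bool" where
  "rectifiable_curve a b \<gamma> \<longleftrightarrow> is_curve a b \<gamma> \<and> curve_length a b \<gamma> < \<infinity>"

text \<open>
  In particular \<open>l\<close> is the length of \<open>\<gamma>\<close>; the case \<open>l = 0\<close> gives exactly the constant curves.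
\<close>

definition arc_length_curve :: "real \<Rightarrow> (real \<Rightarrow> 'a::metric_space) \<Rightarrow> bool" where
  "arc_length_curve l \<gamma> \<longleftrightarrow>
     rectifiable_curve 0 l \<gamma> \<and> (\<forall>s\<in>{0..l}. curve_length 0 s \<gamma> = ennreal s)"

text \<open>This is the line integral only if \<open>\<gamma>\<close> is parameterized by arc length on \<open>[0, l]\<close>.\<close>

definition curve_integral :: "('a::metric_space \<Rightarrow> ennreal) \<Rightarrow> real \<Rightarrow> (real \<Rightarrow> 'a) \<Rightarrow> ennreal" where
  "curve_integral \<rho> l \<gamma> = (\<integral>\<^sup>+s\<in>{0..l}. \<rho> (\<gamma> s) \<partial>lborel)"

definition curves_leaving :: "'a::metric_space set \<Rightarrow> 'a \<Rightarrow> (real \<times> (real \<Rightarrow> 'a)) set" where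
  "curves_leaving U x = {(l, \<gamma>). arc_length_curve l \<gamma> \<and> \<gamma> 0 = x \<and> \<gamma> l \<in> - U}"

definition u_fun :: "'a::metric_space set \<Rightarrow> ('a \<Rightarrow> ennreal) \<Rightarrow> 'a \<Rightarrow> ennreal" where
  "u_fun U \<rho> x = (INF (l, \<gamma>) \<in> curves_leaving U x. curve_integral \<rho> l \<gamma>)"

end

theory Submission
  imports Defs
begin

text \<open>An arc-length curve is \<open>1\<close>-Lipschitz, so it is determined by its values at the rationals, and
  the pairs of a curve and its length become points of the Polish space \<open>(rat \<Rightarrow> 'a) \<times> real\<close>.  There
  the length condition and the bound \<open>a\<close> on the line integral of \<open>\<rho>\<close> are Borel conditions, while
  ending outside \<open>U\<close> is an analytic one.  The sublevel set of \<open>u\<^sub>\<rho>\<close> at \<open>a\<close> is the image of the set of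
  all such pairs under evaluation at \<open>0\<close>; it is therefore analytic, and analytic sets are measurable
  for every complete \<open>\<sigma>\<close>-finite Borel measure.  Analytic sets are handled as projections along
  \<open>nat \<Rightarrow> nat\<close> of closed sets.\<close>

section \<open>Suslin sets\<close>

definition suslin_set :: "'a::topological_space set \<Rightarrow> bool" where
  "suslin_set A \<longleftrightarrow>
    (\<exists>D :: ('a \<times> (nat \<Rightarrow> nat)) set. closed D \<and> (\<forall>x. x \<in> A \<longleftrightarrow> (\<exists>\<sigma>. (x, \<sigma>) \<in> D)))"

lemma suslin_setI:
  fixes D :: "('a::topological_space \<times> (nat \<Rightarrow> nat)) set"
  assumes "closed D" "\<And>x. x \<in> A \<longleftrightarrow> (\<exists>\<sigma>. (x, \<sigma>) \<in> D)"
  shows "suslin_set A"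
  unfolding suslin_set_def using assms by (intro exI[of _ D] conjI allI)

lemma suslin_set_closed:
  assumes "closed A"
  shows "suslin_set A"
  by (rule suslin_setI[of "A \<times> UNIV"]) (auto intro: closed_Times assms)

text \<open>Reindexing a sequence is continuous for any \<open>p\<close>, so a single sequence can
  carry several witnesses, each read off from its own set of coordinates.\<close>

lemma closed_proj_coordinate:
  fixes D :: "('a::topological_space \<times> (nat \<Rightarrow> nat)) set"
  assumes "closed D"
  shows "closed {(x, \<sigma> :: nat \<Rightarrow> nat). (x, \<lambda>k. \<sigma> (p k)) \<in> D}"
proof -
  have "continuous_on UNIV (\<lambda>(x :: 'a, \<sigma> :: nat \<Rightarrow> nat). (x, \<lambda>k. \<sigma> (p k)))"
    unfolding case_prod_beta
    by (intro continuous_intros continuous_on_product_then_coordinatewise)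
  from closed_vimage[OF assms this]
  show ?thesis by (simp add: vimage_def case_prod_beta')
qed

text \<open>A pairing function packs one witness for each \<open>A n\<close> into a single sequence.
  Membership in the intersection is then one closed condition for each \<open>n\<close>, all on the
  same sequence.\<close>

lemma suslin_set_INT:
  assumes "\<And>n :: nat. suslin_set (A n)"
  shows "suslin_set (\<Inter>n. A n)"
proof -
  have "\<forall>n. \<exists>D :: ('a \<times> (nat \<Rightarrow> nat)) set. closed D \<and> (\<forall>x. x \<in> A n \<longleftrightarrow> (\<exists>\<sigma>. (x, \<sigma>) \<in> D))"
    using assms unfolding suslin_set_def by (rule allI)
  then obtain D :: "nat \<Rightarrow> ('a \<times> (nat \<Rightarrow> nat)) set"
    where D: "\<And>n. closed (D n)" "\<And>n x. x \<in> A n \<longleftrightarrow> (\<exists>\<sigma>. (x, \<sigma>) \<in> D n)"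
    by metis
  have "x \<in> (\<Inter>n. A n) \<longleftrightarrow> (\<exists>\<sigma>. (x, \<sigma>) \<in> (\<Inter>n. {(x, \<sigma>). (x, \<lambda>k. \<sigma> (prod_encode (n, k))) \<in> D n}))"
    for x
  proof
    assume "x \<in> (\<Inter>n. A n)"
    then obtain \<tau> where \<tau>: "\<And>n. (x, \<tau> n) \<in> D n" using D(2) by (metis INT_E UNIV_I)
    show "\<exists>\<sigma>. (x, \<sigma>) \<in> (\<Inter>n. {(x, \<sigma>). (x, \<lambda>k. \<sigma> (prod_encode (n, k))) \<in> D n})"
      by (rule exI[of _ "\<lambda>j. case_prod \<tau> (prod_decode j)"]) (simp add: \<tau>)
  qed (use D(2) in auto)
  then show ?thesis
    by (rule suslin_setI[rotated]) (intro closed_INT ballI closed_proj_coordinate D)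
qed

text \<open>Entry 0 of the sequence names the set to which the point belongs, and the shifted
  sequence is a witness for that set.\<close>

lemma suslin_set_UN:
  assumes "\<And>n :: nat. suslin_set (A n)"
  shows "suslin_set (\<Union>n. A n)"
proof -
  have "\<forall>n. \<exists>D :: ('a \<times> (nat \<Rightarrow> nat)) set. closed D \<and> (\<forall>x. x \<in> A n \<longleftrightarrow> (\<exists>\<sigma>. (x, \<sigma>) \<in> D))"
    using assms unfolding suslin_set_def by (rule allI)
  then obtain D :: "nat \<Rightarrow> ('a \<times> (nat \<Rightarrow> nat)) set"
    where D: "\<And>n. closed (D n)" "\<And>n x. x \<in> A n \<longleftrightarrow> (\<exists>\<sigma>. (x, \<sigma>) \<in> D n)"
    by metis
  \<comment> \<open>Written as an implication for each \<open>n\<close>, so that the whole condition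
    is an intersection of closed sets. The implication is closed because fixing entry 0 is an open
    condition.\<close>
  let ?E = "\<lambda>n. {p. snd p 0 = n \<longrightarrow> p \<in> {(x, \<sigma>). (x, \<lambda>k. \<sigma> (Suc k)) \<in> D n}}"
  have cl: "closed (?E n)" for n
  proof (rule closed_Collect_imp)
    have "continuous_on UNIV (\<lambda>p :: 'a \<times> (nat \<Rightarrow> nat). snd p 0)"
      by (rule continuous_on_product_then_coordinatewise[OF continuous_on_snd[OF continuous_on_id]])
    from open_vimage[OF open_discrete this, of "{n}"]
    show "open {p :: 'a \<times> (nat \<Rightarrow> nat). snd p 0 = n}" by (simp add: vimage_def)
  qed (use closed_proj_coordinate[OF D(1)] in simp)
  have "x \<in> (\<Union>n. A n) \<longleftrightarrow> (\<exists>\<sigma>. (x, \<sigma>) \<in> (\<Inter>n. ?E n))" for x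
  proof
    assume "x \<in> (\<Union>n. A n)"
    then obtain n \<tau> where \<tau>: "(x, \<tau>) \<in> D n" using D(2) by auto
    show "\<exists>\<sigma>. (x, \<sigma>) \<in> (\<Inter>n. ?E n)"
      by (rule exI[of _ "case_nat n \<tau>"]) (simp add: \<tau>)
  qed (use D(2) in auto)
  then show ?thesis
    by (rule suslin_setI[rotated]) (intro closed_INT ballI cl)
qed

lemma suslin_set_Int:
  assumes "suslin_set A" "suslin_set B"
  shows "suslin_set (A \<inter> B)"
proof -
  have "A \<inter> B = (\<Inter>n :: nat. if n = 0 then A else B)" by (auto split: if_splits)
  then show ?thesis using suslin_set_INT[of "\<lambda>n. if n = 0 then A else B"] assms by auto
qed

lemma suslin_set_Un:
  assumes "suslin_set A" "suslin_set B"
  shows "suslin_set (A \<union> B)"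
proof -
  have "A \<union> B = (\<Union>n :: nat. if n = 0 then A else B)" by (auto split: if_splits)
  then show ?thesis using suslin_set_UN[of "\<lambda>n. if n = 0 then A else B"] assms by auto
qed

lemma suslin_set_INT_countable:
  assumes "countable I" "\<And>i. i \<in> I \<Longrightarrow> suslin_set (A i)"
  shows "suslin_set (\<Inter>i\<in>I. A i)"
proof (cases "I = {}")
  case False
  then have "I = range (from_nat_into I)" using assms(1) by simp
  then have "(\<Inter>i\<in>I. A i) = (\<Inter>n. A (from_nat_into I n))"
    by (metis image_image)
  then show ?thesis using suslin_set_INT[of "\<lambda>n. A (from_nat_into I n)"] assms(2) False
    by (simp add: from_nat_into)
qed (simp add: suslin_set_closed)

text \<open>In a metric space an open set is a countable union of closed sets: the points at
  distance at least 1/(n+1) from the complement.\<close>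

lemma suslin_set_open:
  fixes A :: "'a::metric_space set"
  assumes "open A"
  shows "suslin_set A"
proof -
  define F where "F n = {x. infdist x (- A) \<ge> inverse (real (Suc n))}" for n
  have F: "suslin_set (F n)" for n
    unfolding F_def by (intro suslin_set_closed closed_Collect_le continuous_intros)
  show ?thesis
  \<comment> \<open>The whole space is treated apart because \<open>infdist\<close> to the empty set
    is 0 by convention.\<close>
  proof (cases "A = UNIV")
    case False
    have "x \<in> A \<longleftrightarrow> (\<exists>n. x \<in> F n)" for x
    proof -
      have "x \<in> A \<longleftrightarrow> infdist x (- A) > 0"
        using assms False in_closed_iff_infdist_zero[of "- A" x] infdist_nonneg[of x "- A"]
        by (auto simp: closed_def less_le)
      also have "\<dots> \<longleftrightarrow> (\<exists>n. x \<in> F n)"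
        unfolding F_def mem_Collect_eq
        by (meson inverse_positive_iff_positive less_le_trans of_nat_0_less_iff
            real_arch_inverse reals_Archimedean less_imp_le zero_less_Suc)
      finally show ?thesis .
    qed
    then have "A = (\<Union>n. F n)" by auto
    then show ?thesis using suslin_set_UN[of F] F by simp
  qed (simp add: suslin_set_closed)
qed

text \<open>Suslin sets are in general not closed under complement, so the induction over the Borel
  sets carries the claim for a set and its complement together; each then supplies the complement
  step for the other.\<close>

lemma suslin_set_borel:
  fixes A :: "'a::metric_space set"
  assumes "A \<in> sets borel"
  shows "suslin_set A"
proof -
  have "A \<in> sigma_sets UNIV {S. open S}" using assms by (simp add: borel_def)
  then have "suslin_set A \<and> suslin_set (- A)"
  proof induction
    case (Union a)
    then show ?case by (auto simp: Compl_UN intro: suslin_set_UN suslin_set_INT)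
  qed (auto simp: Compl_eq_Diff_UNIV[symmetric] closed_Compl suslin_set_closed suslin_set_open)
  then show ?thesis by simp
qed

text \<open>The projected sequence and the witness are interleaved as the even and the odd entries
  of one sequence.\<close>

lemma suslin_set_fst_image:
  fixes B :: "('a::topological_space \<times> (nat \<Rightarrow> nat)) set"
  assumes "suslin_set B"
  shows "suslin_set (fst ` B)"
proof -
  obtain D :: "(('a \<times> (nat \<Rightarrow> nat)) \<times> (nat \<Rightarrow> nat)) set"
    where D: "closed D" "\<And>x. x \<in> B \<longleftrightarrow> (\<exists>\<sigma>. (x, \<sigma>) \<in> D)"
    using assms(1)[unfolded suslin_set_def] by metis
  define f where "f = (\<lambda>(x :: 'a, \<sigma> :: nat \<Rightarrow> nat). ((x, \<lambda>k. \<sigma> (2 * k)), \<lambda>k. \<sigma> (2 * k + 1)))"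
  have "continuous_on UNIV f"
    unfolding f_def case_prod_beta
    by (intro continuous_intros continuous_on_product_then_coordinatewise)
  then have cl: "closed (f -` D)" by (rule closed_vimage[OF D(1)])
  have "x \<in> fst ` B \<longleftrightarrow> (\<exists>\<sigma>. (x, \<sigma>) \<in> f -` D)" for x
  proof
    assume "x \<in> fst ` B"
    then obtain \<tau> \<sigma> where "((x, \<tau>), \<sigma>) \<in> D" using D(2) by auto
    then show "\<exists>\<sigma>. (x, \<sigma>) \<in> f -` D"
      by (intro exI[of _ "\<lambda>k. if even k then \<tau> (k div 2) else \<sigma> (k div 2)"]) (simp add: f_def)
  qed (use D(2) in \<open>force simp: f_def\<close>)
  then show ?thesis by (rule suslin_setI[OF cl])
qed

lemma suslin_set_vimage_continuous:
  assumes "suslin_set A" and g: "continuous_on UNIV g"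
  shows "suslin_set (g -` A)"
proof -
  obtain D :: "('a \<times> (nat \<Rightarrow> nat)) set"
    where D: "closed D" "\<And>x. x \<in> A \<longleftrightarrow> (\<exists>\<sigma>. (x, \<sigma>) \<in> D)"
    using assms(1)[unfolded suslin_set_def] by metis
  have "continuous_on UNIV (\<lambda>p :: 'b \<times> (nat \<Rightarrow> nat). (g (fst p), snd p))"
    by (intro continuous_intros continuous_on_compose2[OF g]) auto
  from closed_vimage[OF D(1) this] show ?thesis
    by (rule suslin_setI) (simp add: D(2))
qed

text \<open>The space of sequences carries no metric here, so the preimage of a closed subset of the product
  is not handled as a Borel set but by writing the complement as a countable union of open boxes.\<close>

lemma image_fst_iff: "x \<in> fst ` S \<longleftrightarrow> (\<exists>y. (x, y) \<in> S)"
  by force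

lemma suslin_set_vimage:
  fixes g :: "'b::metric_space \<Rightarrow> 'a::second_countable_topology"
  assumes "suslin_set A" and g: "g \<in> borel_measurable borel"
  shows "suslin_set (g -` A)"
proof -
  obtain D :: "('a \<times> (nat \<Rightarrow> nat)) set"
    where D: "closed D" "\<And>x. x \<in> A \<longleftrightarrow> (\<exists>\<sigma>. (x, \<sigma>) \<in> D)"
    using assms(1)[unfolded suslin_set_def] by metis
  obtain \<B> :: "'a set set" where \<B>: "countable \<B>" "topological_basis \<B>"
    using ex_countable_basis by blast
  obtain \<C> :: "(nat \<Rightarrow> nat) set set" where \<C>: "countable \<C>" "topological_basis \<C>"
    using ex_countable_basis by blast
  \<comment> \<open>The basic open boxes that miss \<open>D\<close>. They are countably many and
    cover the complement of \<open>D\<close>.\<close>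
  define I where "I = {(G, H). G \<in> \<B> \<and> H \<in> \<C> \<and> G \<times> H \<subseteq> - D}"
  have "countable I"
    by (rule countable_subset[OF _ countable_SIGMA[OF \<B>(1) \<C>(1)]]) (auto simp: I_def)
  have D_eq: "p \<in> D \<longleftrightarrow> (\<forall>(G, H)\<in>I. fst p \<in> G \<longrightarrow> snd p \<notin> H)" for p
  proof
    assume R: "\<forall>(G, H)\<in>I. fst p \<in> G \<longrightarrow> snd p \<notin> H"
    show "p \<in> D"
    proof (rule ccontr)
      assume "p \<notin> D"
      then obtain U V where UV: "open U" "open V" "p \<in> U \<times> V" "U \<times> V \<subseteq> - D"
        using D(1) open_prod_elim[of "- D" p] by (auto simp: closed_def)
      obtain G where "G \<in> \<B>" "fst p \<in> G" "G \<subseteq> U"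
        using UV topological_basisE[OF \<B>(2), of U "fst p"] by (metis mem_Times_iff)
      moreover obtain H where "H \<in> \<C>" "snd p \<in> H" "H \<subseteq> V"
        using UV topological_basisE[OF \<C>(2), of V "snd p"] by (metis mem_Times_iff)
      ultimately show False using R UV(4) by (fastforce simp: I_def)
    qed
  qed (cases p, auto simp: I_def)
  \<comment> \<open>The pairs whose image under (w, \<sigma>) \<mapsto> (g w, \<sigma>) avoids the
    box G \<times> H. The first part is a Borel set in \<open>w\<close> alone and the second is
    closed in \<sigma> alone.\<close>
  let ?S = "\<lambda>(G, H). (fst -` (g -` (- G)) \<union> snd -` (- H)) :: ('b \<times> (nat \<Rightarrow> nat)) set"
  have S: "suslin_set (?S i)" if i_in: "i \<in> I" for i
  proof -
    obtain G H where i: "i = (G, H)" "G \<in> \<B>" "H \<in> \<C>" using i_in by (auto simp: I_def)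
    have GH: "open G" "open H" using i \<B>(2) \<C>(2) by (auto intro: topological_basis_open)
    have "g -` (- G) \<in> sets borel"
      using measurable_sets[OF g, of "- G"] GH by auto
    then have "suslin_set (fst -` (g -` (- G)) :: ('b \<times> (nat \<Rightarrow> nat)) set)"
      by (intro suslin_set_vimage_continuous suslin_set_borel continuous_on_fst continuous_on_id)
    moreover have "suslin_set (snd -` (- H) :: ('b \<times> (nat \<Rightarrow> nat)) set)"
      using GH by (intro suslin_set_closed closed_vimage continuous_on_snd continuous_on_id)
        (simp add: closed_Compl)
    ultimately show ?thesis unfolding i prod.case by (rule suslin_set_Un)
  qed
  have "suslin_set (\<Inter>i\<in>I. ?S i)" using \<open>countable I\<close> S by (rule suslin_set_INT_countable)
  then have "suslin_set (fst ` (\<Inter>i\<in>I. ?S i))" by (rule suslin_set_fst_image)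
  also have "fst ` (\<Inter>i\<in>I. ?S i) = g -` A"
  proof -
    have *: "(w, \<sigma>) \<in> (\<Inter>i\<in>I. ?S i) \<longleftrightarrow> (g w, \<sigma>) \<in> D" for w \<sigma>
      unfolding D_eq[of "(g w, \<sigma>)"] by (simp add: case_prod_beta)
    show ?thesis
    proof (intro set_eqI)
      fix w
      have "w \<in> fst ` (\<Inter>i\<in>I. ?S i) \<longleftrightarrow> (\<exists>\<sigma>. (w, \<sigma>) \<in> (\<Inter>i\<in>I. ?S i))"
        by (rule image_fst_iff)
      then show "w \<in> fst ` (\<Inter>i\<in>I. ?S i) \<longleftrightarrow> w \<in> g -` A"
        unfolding * vimage_eq D(2) .
    qed
  qed
  finally show ?thesis .
qed

section \<open>Parametrization by sequences of naturals; analytic sets and continuous images\<close>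

text \<open>A sequence of naturals is read as a sequence of indices into a countable dense set.
  Those that converge at a prescribed rate form a closed set, and the limit depends continuously on
  the indices.\<close>

lemma complete_separable_baire_image:
  fixes m :: "'b metric"
  assumes "mcomplete_of m" "separable_space (mtopology_of m)"
  obtains C :: "(nat \<Rightarrow> nat) set" and h
  where "closed C" "continuous_map (top_of_set C) (mtopology_of m) h" "h ` C = mspace m"
proof (cases "mspace m = {}")
  case True
  show ?thesis by (rule that[of "{}" "\<lambda>_. undefined"]) (auto simp: True continuous_map_def)
next
  case False
  interpret Metric_space "mspace m" "mdist m" by simp
  obtain C0 where C0: "countable C0" "C0 \<subseteq> mspace m" "mtopology closure_of C0 = mspace m"
    using assms(2) by (auto simp: separable_space_def mtopology_of_def)
  with False have "C0 \<noteq> {}" by auto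
  define c where "c = from_nat_into C0"
  have c_in: "c n \<in> mspace m" for n
    using C0(2) from_nat_into[OF \<open>C0 \<noteq> {}\<close>, of n] by (auto simp: c_def)
  have c_dense: "\<exists>k. mdist m (c k) z < e" if z: "z \<in> mspace m" and e: "e > 0" for z e
  proof -
    have "z \<in> mtopology closure_of C0" using C0 z by simp
    then obtain y where "y \<in> C0" "mdist m z y < e"
      unfolding metric_closure_of in_mball mem_Collect_eq using e by blast
    moreover obtain k where "from_nat_into C0 k = y"
      using from_nat_into_surj[OF C0(1) \<open>y \<in> C0\<close>] by blast
    ultimately have "mdist m (c k) z < e" by (simp add: c_def commute)
    then show ?thesis by blast
  qed
  \<comment> \<open>A Cauchy bound on pairs of terms, without mention of the limit: each instance
    involves only two coordinates, so \<open>C\<close> is closed. Letting j tend to infinity bounds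
    the distance of term i to the limit by (1/2)^i.\<close>
  define C where "C = {\<sigma>. \<forall>i j. mdist m (c (\<sigma> i)) (c (\<sigma> j)) \<le> (1/2)^i + (1/2)^j}"
  have "closed C"
    unfolding C_def
  proof (intro closed_Collect_all)
    fix i j
    have "continuous_on UNIV (\<lambda>\<sigma> :: nat \<Rightarrow> nat. \<sigma> k)" for k by simp
    then have "open ({\<sigma> :: nat \<Rightarrow> nat. \<sigma> k = v})" for k v
      using open_vimage[OF open_discrete, of "\<lambda>\<sigma>. \<sigma> k" "{v}"] by (simp add: vimage_def)
    then have "open ({\<sigma> :: nat \<Rightarrow> nat. \<sigma> i = v} \<inter> {\<sigma>. \<sigma> j = w})" for v w by blast
    then have "open (\<Union>(v, w)\<in>{(v, w). \<not> mdist m (c v) (c w) \<le> (1/2)^i + (1/2)^j}.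
        {\<sigma> :: nat \<Rightarrow> nat. \<sigma> i = v} \<inter> {\<sigma>. \<sigma> j = w})" by auto
    also have "\<dots> = - {\<sigma>. mdist m (c (\<sigma> i)) (c (\<sigma> j)) \<le> (1/2)^i + (1/2)^j}" by auto
    finally show "closed {\<sigma>. mdist m (c (\<sigma> i)) (c (\<sigma> j)) \<le> (1/2)^i + (1/2)^j}"
      by (simp add: closed_def)
  qed
  have ex: "\<exists>z. z \<in> mspace m \<and> (\<forall>i. mdist m (c (\<sigma> i)) z \<le> (1/2)^i)" if "\<sigma> \<in> C" for \<sigma>
  proof -
    have le: "mdist m (c (\<sigma> i)) (c (\<sigma> j)) \<le> (1/2)^i + (1/2)^j" for i j using that by (simp add: C_def)
    have "MCauchy (\<lambda>n. c (\<sigma> n))"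
      unfolding MCauchy_def
    proof (intro conjI allI impI)
      fix e :: real assume "e > 0"
      then obtain N where N: "(1/2::real)^N < e / 2"
        using real_arch_pow_inv[of "e/2" "1/2"] by auto
      have "mdist m (c (\<sigma> n)) (c (\<sigma> n')) < e" if "N \<le> n" "N \<le> n'" for n n'
      proof -
        have "(1/2::real)^n \<le> (1/2)^N" "(1/2::real)^n' \<le> (1/2)^N"
          using that by (auto intro: power_decreasing)
        with le[of n n'] N show ?thesis by linarith
      qed
      then show "\<exists>N. \<forall>n n'. N \<le> n \<longrightarrow> N \<le> n' \<longrightarrow> mdist m (c (\<sigma> n)) (c (\<sigma> n')) < e" by blast
    qed (use c_in in auto)
    then obtain z where z: "limitin mtopology (\<lambda>n. c (\<sigma> n)) z sequentially"
      using assms(1) unfolding mcomplete_of_def mcomplete_def by blast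
    then have zin: "z \<in> mspace m" by (rule limitin_mspace)
    have "mdist m (c (\<sigma> i)) z \<le> (1/2)^i" for i
    proof (rule field_le_epsilon)
      fix e :: real assume "e > 0"
      obtain N where N: "\<And>n. n \<ge> N \<Longrightarrow> mdist m (c (\<sigma> n)) z < e / 2"
        using z \<open>e > 0\<close> half_gt_zero[of e] unfolding limitin_metric eventually_sequentially
        by blast
      obtain K where K: "(1/2::real)^K < e / 2"
        using real_arch_pow_inv[of "e/2" "1/2"] \<open>e > 0\<close> by auto
      define n where "n = max N K"
      have "(1/2::real)^n \<le> (1/2)^K" by (intro power_decreasing) (auto simp: n_def)
      moreover have "mdist m (c (\<sigma> i)) z \<le> mdist m (c (\<sigma> i)) (c (\<sigma> n)) + mdist m (c (\<sigma> n)) z"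
        using triangle[OF c_in c_in zin] .
      moreover have "mdist m (c (\<sigma> n)) z < e / 2" using N by (simp add: n_def)
      ultimately show "mdist m (c (\<sigma> i)) z \<le> (1/2)^i + e" using le[of i n] K by linarith
    qed
    with zin show ?thesis by blast
  qed
  define h where "h \<sigma> = (SOME z. z \<in> mspace m \<and> (\<forall>i. mdist m (c (\<sigma> i)) z \<le> (1/2)^i))" for \<sigma>
  have h: "h \<sigma> \<in> mspace m" "mdist m (c (\<sigma> i)) (h \<sigma>) \<le> (1/2)^i" if "\<sigma> \<in> C" for \<sigma> i
    using someI_ex[OF ex[OF that]] unfolding h_def by auto
  have "continuous_map (top_of_set C) mtopology h"
    unfolding continuous_map_to_metric
  proof (intro ballI allI impI)
    fix \<sigma> and e :: real assume \<sigma>: "\<sigma> \<in> topspace (top_of_set C)" and "e > 0"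
    obtain K where K: "(1/2::real)^K < e / 2"
      using real_arch_pow_inv[of "e/2" "1/2"] \<open>e > 0\<close> by auto
    \<comment> \<open>Within \<open>C\<close>, agreement with \<sigma> in entry \<open>K\<close>
      alone suffices: both limits then lie within (1/2)^K of the same point
      \<open>c (\<sigma> K)\<close>.\<close>
    have op: "open {\<tau> :: nat \<Rightarrow> nat. \<tau> K = \<sigma> K}"
      using open_vimage[OF open_discrete, of "\<lambda>\<tau>. \<tau> K" "{\<sigma> K}"] by (simp add: vimage_def)
    show "\<exists>U. openin (top_of_set C) U \<and> \<sigma> \<in> U \<and> (\<forall>\<tau>\<in>U. h \<tau> \<in> mball (h \<sigma>) e)"
    proof (intro exI[of _ "C \<inter> {\<tau>. \<tau> K = \<sigma> K}"] conjI ballI)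
      show "openin (top_of_set C) (C \<inter> {\<tau>. \<tau> K = \<sigma> K})" using op by (rule openin_open_Int)
      fix \<tau> assume \<tau>: "\<tau> \<in> C \<inter> {\<tau>. \<tau> K = \<sigma> K}"
      have "mdist m (h \<sigma>) (h \<tau>) \<le> mdist m (h \<sigma>) (c (\<sigma> K)) + mdist m (c (\<sigma> K)) (h \<tau>)"
        using triangle[OF h(1)[of \<sigma>] c_in h(1)[of \<tau>]] \<sigma> \<tau> by simp
      moreover have "mdist m (h \<sigma>) (c (\<sigma> K)) \<le> (1/2)^K" using h(2)[of \<sigma> K] \<sigma> commute by simp
      moreover have "mdist m (c (\<sigma> K)) (h \<tau>) \<le> (1/2)^K" using h(2)[of \<tau> K] \<tau> by simp
      ultimately show "h \<tau> \<in> mball (h \<sigma>) e" using K h(1) \<sigma> \<tau> by auto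
    qed (use \<sigma> in auto)
  qed
  moreover have "h ` C = mspace m"
  proof
    show "h ` C \<subseteq> mspace m" using h by auto
    show "mspace m \<subseteq> h ` C"
    proof
      fix z assume z: "z \<in> mspace m"
      \<comment> \<open>For surjectivity, term i is chosen within (1/2)^i of \<open>z\<close>; the
        triangle inequality through \<open>z\<close> is exactly the bound defining
        \<open>C\<close>.\<close>
      have "\<forall>i. \<exists>k. mdist m (c k) z < (1/2)^i" using c_dense[OF z] by simp
      then obtain \<sigma> where \<sigma>: "\<And>i. mdist m (c (\<sigma> i)) z < (1/2)^i" by metis
      have "\<sigma> \<in> C"
        unfolding C_def
      proof (intro CollectI allI)
        fix i j
        have "mdist m (c (\<sigma> i)) (c (\<sigma> j)) \<le> mdist m (c (\<sigma> i)) z + mdist m (c (\<sigma> j)) z"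
          using triangle[OF c_in z c_in] by (simp add: commute)
        with \<sigma>[of i] \<sigma>[of j] show "mdist m (c (\<sigma> i)) (c (\<sigma> j)) \<le> (1/2)^i + (1/2)^j" by linarith
      qed
      have "mdist m z (h \<sigma>) \<le> 0"
      proof (rule field_le_epsilon)
        fix e :: real assume "e > 0"
        obtain K where K: "(1/2::real)^K < e / 2"
          using real_arch_pow_inv[of "e/2" "1/2"] \<open>e > 0\<close> by auto
        have "mdist m z (h \<sigma>) \<le> mdist m (c (\<sigma> K)) z + mdist m (c (\<sigma> K)) (h \<sigma>)"
          using triangle[OF z c_in h(1)[OF \<open>\<sigma> \<in> C\<close>], of "\<sigma> K"] commute[of z "c (\<sigma> K)"] by simp
        with \<sigma>[of K] h(2)[OF \<open>\<sigma> \<in> C\<close>, of K] K show "mdist m z (h \<sigma>) \<le> 0 + e" by linarith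
      qed
      then have "z = h \<sigma>" using zero[OF z h(1)[OF \<open>\<sigma> \<in> C\<close>]] nonneg[of z "h \<sigma>"] by simp
      with \<open>\<sigma> \<in> C\<close> show "z \<in> h ` C" by blast
    qed
  qed
  ultimately show ?thesis using that \<open>closed C\<close> by (simp add: mtopology_of_def)
qed

lemma closed_equality_relation: "closed {(x, y :: 'a::t2_space). x = y}"
  using closed_Collect_eq[OF continuous_on_fst[OF continuous_on_id] continuous_on_snd[OF continuous_on_id]]
  by (simp add: case_prod_beta')

text \<open>Composing with the parametrization makes \<open>A\<close> a continuous image of a closed
  set of sequences. The graph of this map, with the value as first component, is closed and projects
  onto \<open>A\<close>.\<close>

lemma analytic_set_imp_suslin_set:
  fixes A :: "'a::polish_space set"
  assumes "analytic_set A"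
  shows "suslin_set A"
proof -
  obtain m :: "real metric" and f where m: "mcomplete_of m" "separable_space (mtopology_of m)"
    and f: "continuous_map (mtopology_of m) euclidean f" "A = f ` mspace m"
    using assms by (auto simp: analytic_set_def)
  obtain C :: "(nat \<Rightarrow> nat) set" and h where C: "closed C"
    "continuous_map (top_of_set C) (mtopology_of m) h" "h ` C = mspace m"
    using complete_separable_baire_image[OF m] .
  have "continuous_map (top_of_set C) euclidean (f \<circ> h)"
    using C(2) f(1) by (rule continuous_map_compose)
  then have cont: "continuous_on C (\<lambda>\<sigma>. f (h \<sigma>))" by (simp add: o_def)
  have "closed (UNIV \<times> C \<inter> (\<lambda>p :: 'a \<times> (nat \<Rightarrow> nat). (fst p, f (h (snd p)))) -` {(x, y). x = y})"
    by (intro continuous_closed_preimage continuous_intros continuous_on_compose2[OF cont]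
        closed_Times closed_UNIV C closed_equality_relation) auto
  then show ?thesis
    by (rule suslin_setI) (auto simp: f(2) C(3)[symmetric])
qed

lemma separable_space_euclidean:
  "separable_space (euclidean :: 'a::second_countable_topology topology)"
proof -
  obtain D :: "'a set" where D: "countable D" "\<And>X. open X \<Longrightarrow> X \<noteq> {} \<Longrightarrow> \<exists>d\<in>D. d \<in> X"
    using countable_dense_setE by blast
  have "closure D = UNIV"
    unfolding closure_interior using D(2)[of "interior (- D)"] interior_subset[of "- D"] by auto
  then show ?thesis using D(1) by (auto simp: separable_space_def)
qed

text \<open>The existential quantifier over points of the domain is turned into one over sequences
  by parametrizing the domain. The image is then obtained from a closed set by projecting along two
  sequences.\<close>

lemma suslin_set_image:
  fixes \<phi> :: "'z::{complete_space, second_countable_topology} \<Rightarrow> 'a::metric_space"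
  assumes "suslin_set S" and \<phi>: "continuous_on UNIV \<phi>"
  shows "suslin_set (\<phi> ` S)"
proof -
  have "mcomplete_of (euclidean_metric :: 'z metric)"
    "separable_space (mtopology_of (euclidean_metric :: 'z metric))"
    by (simp_all add: mcomplete_of_def complete_UNIV separable_space_euclidean)
  from complete_separable_baire_image[OF this]
  obtain C and h :: "(nat \<Rightarrow> nat) \<Rightarrow> 'z" where C: "closed C"
    "continuous_map (top_of_set C) (mtopology_of euclidean_metric) h" "h ` C = mspace euclidean_metric" .
  obtain D :: "('z \<times> (nat \<Rightarrow> nat)) set"
    where D: "closed D" "\<And>x. x \<in> S \<longleftrightarrow> (\<exists>\<sigma>. (x, \<sigma>) \<in> D)"
    using assms(1)[unfolded suslin_set_def] by metis
  have h: "continuous_on C h" using C(2) by simp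
  have h\<phi>: "continuous_on C (\<lambda>\<tau>. \<phi> (h \<tau>))"
    by (rule continuous_on_compose2[OF \<phi> h]) auto
  \<comment> \<open>The triples ((x, \<tau>), \<sigma>) in which \<tau> codes a point that \<phi>
    sends to \<open>x\<close> and \<sigma> witnesses that this point lies in
    \<open>S\<close>.\<close>
  define E where "E = (UNIV \<times> C) \<times> UNIV \<inter>
    (\<lambda>p :: ('a \<times> (nat \<Rightarrow> nat)) \<times> (nat \<Rightarrow> nat).
      ((fst (fst p), \<phi> (h (snd (fst p)))), (h (snd (fst p)), snd p))) -` ({(x, y). x = y} \<times> D)"
  have "closed E"
    unfolding E_def
    by (intro continuous_closed_preimage continuous_intros continuous_on_compose2[OF h]
        continuous_on_compose2[OF h\<phi>] closed_Times closed_UNIV C D closed_equality_relation) auto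
  then have "suslin_set (fst ` E)"
    by (rule suslin_setI) (rule image_fst_iff)
  then have "suslin_set (fst ` fst ` E)" by (rule suslin_set_fst_image)
  moreover have "fst ` fst ` E = \<phi> ` S"
  proof (intro equalityI subsetI)
    fix x assume "x \<in> fst ` fst ` E"
    then obtain \<tau> \<sigma> where "x = \<phi> (h \<tau>)" "(h \<tau>, \<sigma>) \<in> D" by (auto simp: E_def)
    moreover from this(2) have "h \<tau> \<in> S" unfolding D(2) by (rule exI[of _ \<sigma>])
    ultimately show "x \<in> \<phi> ` S" by simp
  next
    fix x assume "x \<in> \<phi> ` S"
    then obtain z where "z \<in> S" "x = \<phi> z" by blast
    moreover from this(1) obtain \<sigma> where "(z, \<sigma>) \<in> D" unfolding D(2) by (elim exE)
    ultimately have z: "x = \<phi> z" "(z, \<sigma>) \<in> D" by simp_all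
    have "z \<in> h ` C" by (simp add: C(3))
    then obtain \<tau> where "\<tau> \<in> C" "z = h \<tau>" by (elim imageE)
    with z have "((x, \<tau>), \<sigma>) \<in> E" by (simp add: E_def)
    then show "x \<in> fst ` fst ` E"
      unfolding image_fst_iff by (intro exI[of _ \<tau>] exI[of _ \<sigma>])
  qed
  ultimately show ?thesis by simp
qed

text \<open>The classical argument that measurability is preserved by the Suslin operation: each section
  of the scheme is replaced by a measurable hull, and the defects of the hulls are null.\<close>

lemma suslin_set_measurable:
  fixes A :: "'a::topological_space set"
  assumes "complete_measure M" "sigma_finite_measure M"
    and sp: "space M = UNIV" and bor: "sets borel \<subseteq> sets M" and "suslin_set A"
  shows "A \<in> sets M"
proof -
  interpret complete_measure M by fact
  interpret sigma_finite_measure M by fact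
  obtain D :: "('a \<times> (nat \<Rightarrow> nat)) set"
    where D: "closed D" "\<And>x. x \<in> A \<longleftrightarrow> (\<exists>\<sigma>. (x, \<sigma>) \<in> D)"
    using assms(5)[unfolded suslin_set_def] by metis
  \<comment> \<open>The points of \<open>A\<close> that have a witness starting with the finite
    sequence \<open>s\<close>; \<open>S []\<close> is \<open>A\<close> itself.\<close>
  define S where "S s = {x. \<exists>\<sigma>. (\<forall>i<length s. \<sigma> i = s ! i) \<and> (x, \<sigma>) \<in> D}" for s :: "nat list"
  obtain C :: "nat \<Rightarrow> 'a set" where C: "range C \<subseteq> sets M" "(\<Union>i. C i) = space M"
    "\<And>i. emeasure M (C i) \<noteq> \<infinity>"
    using sigma_finite by auto
  have "\<exists>E. measurable_envelope M (S s) E" for s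
    using measurable_envelopeI_countable_cover[of "S s" C M] C sp by (auto simp: less_top)
  then obtain E where E: "\<And>s. measurable_envelope M (S s) (E s)" by metis
  \<comment> \<open>Cutting the hull down to the closure of \<open>S s\<close> keeps it measurable,
    and allows a point lying in the hulls along a whole branch to be approximated from
    \<open>D\<close>.\<close>
  define B where "B s = E s \<inter> closure (S s)" for s
  have B_sets: "B s \<in> sets M" for s
    using measurable_envelopeD(2)[OF E[of s]] subsetD[OF bor borel_closed[OF closed_closure]]
    by (auto simp: B_def)
  have S_B: "S s \<subseteq> B s" for s
    using measurable_envelopeD(1)[OF E[of s]] closure_subset by (auto simp: B_def)
  have S_step: "S s = (\<Union>k. S (s @ [k]))" for s
  proof (intro equalityI subsetI)
    fix x assume "x \<in> S s"
    then obtain \<sigma> where "\<forall>i<length s. \<sigma> i = s ! i" "(x, \<sigma>) \<in> D" by (auto simp: S_def)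
    then have "x \<in> S (s @ [\<sigma> (length s)])"
      unfolding S_def by (intro CollectI exI[of _ \<sigma>]) (auto simp: nth_append less_Suc_eq)
    then show "x \<in> (\<Union>k. S (s @ [k]))" by blast
  next
    fix x assume "x \<in> (\<Union>k. S (s @ [k]))"
    then obtain k \<sigma> where "\<forall>i<Suc (length s). \<sigma> i = (s @ [k]) ! i" "(x, \<sigma>) \<in> D"
      by (auto simp: S_def)
    then show "x \<in> S s"
      unfolding S_def by (intro CollectI exI[of _ \<sigma>]) (auto simp: nth_append)
  qed
  define N where "N = (\<Union>s. B s - (\<Union>k. B (s @ [k])))"
  have "N \<in> null_sets M"
    unfolding N_def
  proof (rule null_sets_UN)
    fix s
    have F: "B s - (\<Union>k. B (s @ [k])) \<in> sets M" using B_sets by auto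
    \<comment> \<open>The sets \<open>S (s @ [k])\<close> cover \<open>S s\<close> and lie in their
      hulls, so what the hulls miss of \<open>B s\<close> lies in \<open>E s - S s\<close>. Every
      measurable subset of the latter is null.\<close>
    have "B s - (\<Union>k. B (s @ [k])) \<subseteq> E s - S s"
      using S_step[of s] S_B by (auto simp: B_def[of s])
    then show "B s - (\<Union>k. B (s @ [k])) \<in> null_sets M"
      using F measurable_envelopeD1[OF E F] by auto
  qed
  have "B [] - N \<subseteq> A"
  proof
    fix x assume x: "x \<in> B [] - N"
    then have step: "\<exists>k. x \<in> B (s @ [k])" if "x \<in> B s" for s
      using that by (auto simp: N_def)
    \<comment> \<open>Outside \<open>N\<close> a prefix whose hull contains \<open>x\<close> can
      always be prolonged by one entry; iterating yields a branch \<sigma> with \<open>x\<close> in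
      the hull of each of its prefixes.\<close>
    define f where "f s = s @ [SOME k. x \<in> B (s @ [k])]" for s
    define w where "w n = (f ^^ n) []" for n
    have w_Suc: "w (Suc n) = w n @ [SOME k. x \<in> B (w n @ [k])]" for n by (simp add: w_def f_def)
    have wB: "x \<in> B (w n)" for n
    proof (induction n)
      case (Suc n)
      show ?case unfolding w_Suc by (rule someI_ex[OF step[OF Suc]])
    qed (use x in \<open>simp add: w_def\<close>)
    have len: "length (w n) = n" for n by (induction n) (simp_all add: w_Suc, simp add: w_def)
    define \<sigma> where "\<sigma> i = w (Suc i) ! i" for i
    have w_nth: "w n ! i = \<sigma> i" if "i < n" for n i
      using that
    proof (induction n)
      case (Suc n)
      show ?case
      proof (cases "i < n")
        case True
        then show ?thesis using Suc.IH by (simp add: w_Suc[of n] nth_append len)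
      next
        case False
        then have "i = n" using Suc.prems by simp
        then show ?thesis by (simp add: \<sigma>_def)
      qed
    qed simp
    have "(x, \<sigma>) \<in> D"
    proof (rule ccontr)
      assume "(x, \<sigma>) \<notin> D"
      then have "(x, \<sigma>) \<in> - D" "open (- D)" using D(1) by (simp_all add: closed_def)
      then obtain G H where GH: "open G" "open H" "(x, \<sigma>) \<in> G \<times> H" "G \<times> H \<subseteq> - D"
        using open_prod_elim[of "- D" "(x, \<sigma>)"] by metis
      \<comment> \<open>A neighbourhood of \<sigma> constrains only finitely many entries, hence
        contains every sequence that shares a long enough prefix with \<sigma>. The closure in
        \<open>B\<close> then provides a point of \<open>D\<close> in the box, a
        contradiction.\<close>
      have "openin (product_topology (\<lambda>_ :: nat. euclidean :: nat topology) UNIV) H" "\<sigma> \<in> H"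
        using GH by (simp_all add: euclidean_product_topology)
      from product_topology_open_contains_basis[OF this]
      obtain X where X: "\<sigma> \<in> Pi\<^sub>E UNIV X" "finite {i. X i \<noteq> UNIV}" "Pi\<^sub>E UNIV X \<subseteq> H"
        by (simp only: topspace_euclidean) metis
      obtain n where n: "\<And>i. X i \<noteq> UNIV \<Longrightarrow> i < n"
        using X(2) unfolding finite_nat_set_iff_bounded by auto
      have "x \<in> closure (S (w n))" using wB by (simp add: B_def)
      then obtain y where y: "y \<in> S (w n)" "y \<in> G"
        using GH open_Int_closure_eq_empty[of G "S (w n)"] by auto
      then obtain \<tau> where \<tau>: "\<And>i. i < n \<Longrightarrow> \<tau> i = \<sigma> i" "(y, \<tau>) \<in> D"
        by (auto simp: S_def len w_nth)
      have "\<tau> \<in> Pi\<^sub>E UNIV X"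
        unfolding PiE_UNIV_domain
      proof
        fix i show "\<tau> i \<in> X i"
          using X(1) n[of i] \<tau>(1)[of i] by (cases "X i = UNIV") (auto simp: PiE_iff)
      qed
      then have "(y, \<tau>) \<in> G \<times> H" using y(2) X(3) by (simp add: subset_iff)
      then show False using \<tau>(2) subsetD[OF GH(4)] by auto
    qed
    then show "x \<in> A" unfolding D(2) by (rule exI[of _ \<sigma>])
  qed
  moreover have "A \<subseteq> B []" using S_B[of "[]"] by (simp add: S_def D(2) subset_iff)
  \<comment> \<open>The difference is contained in the null set \<open>N\<close>, so completeness of
    \<open>M\<close> makes it measurable.\<close>
  ultimately have "B [] - A \<in> sets M"
    using \<open>N \<in> null_sets M\<close> by (intro complete[of "B [] - A" N]) auto
  moreover have "A = B [] - (B [] - A)" using \<open>A \<subseteq> B []\<close> by auto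
  ultimately show ?thesis using sets.Diff[OF B_sets[of "[]"]] by metis
qed

section \<open>Lipschitz curves and their values at the rationals\<close>

lemma floor_approx_tendsto:
  "(\<lambda>n. real_of_int \<lfloor>real (Suc n) * x\<rfloor> / real (Suc n)) \<longlonglongrightarrow> x"
proof (rule real_tendsto_sandwich)
  show "\<forall>\<^sub>F n in sequentially. x - inverse (real (Suc n)) \<le> real_of_int \<lfloor>real (Suc n) * x\<rfloor> / real (Suc n)"
  proof (rule always_eventually, rule allI)
    fix n
    have "x - inverse (real (Suc n)) = (real (Suc n) * x - 1) / real (Suc n)"
      by (simp add: field_simps)
    also have "\<dots> \<le> real_of_int \<lfloor>real (Suc n) * x\<rfloor> / real (Suc n)"
      by (intro divide_right_mono) linarith+
    finally show "x - inverse (real (Suc n)) \<le> real_of_int \<lfloor>real (Suc n) * x\<rfloor> / real (Suc n)" .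
  qed
  show "\<forall>\<^sub>F n in sequentially. real_of_int \<lfloor>real (Suc n) * x\<rfloor> / real (Suc n) \<le> x"
  proof (rule always_eventually, rule allI)
    fix n
    have "real_of_int \<lfloor>real (Suc n) * x\<rfloor> / real (Suc n) \<le> (real (Suc n) * x) / real (Suc n)"
      by (intro divide_right_mono) linarith+
    then show "real_of_int \<lfloor>real (Suc n) * x\<rfloor> / real (Suc n) \<le> x" by simp
  qed
  show "(\<lambda>n. x - inverse (real (Suc n))) \<longlonglongrightarrow> x"
    using tendsto_diff[OF tendsto_const LIMSEQ_inverse_real_of_nat, of x] by simp
qed simp

text \<open>Rounding down to multiples of 1/(n+1) is monotone in \<open>s\<close> and exact at 0 and
  1. Hence it maps partitions of [0, 1] to rational partitions with the same end points.\<close>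

definition rat_approx :: "nat \<Rightarrow> real \<Rightarrow> rat" where
  "rat_approx n s = of_int \<lfloor>real (Suc n) * s\<rfloor> / of_nat (Suc n)"

lemma rat_approx_tendsto: "(\<lambda>n. real_of_rat (rat_approx n s)) \<longlonglongrightarrow> s"
  using floor_approx_tendsto[of s]
  unfolding rat_approx_def of_rat_divide of_rat_of_int_eq of_rat_of_nat_eq .

lemma rat_approx_mono: "s \<le> t \<Longrightarrow> rat_approx n s \<le> rat_approx n t"
  unfolding rat_approx_def by (intro divide_right_mono) (auto intro!: floor_mono mult_left_mono)

lemma rat_approx_0: "rat_approx n 0 = 0"
  and rat_approx_1: "rat_approx n 1 = 1"
proof -
  show "rat_approx n 0 = 0" by (simp add: rat_approx_def)
  have "\<lfloor>real (Suc n) * 1\<rfloor> = int (Suc n)" by (simp only: mult_1_right floor_of_nat)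
  then show "rat_approx n 1 = 1" unfolding rat_approx_def by (simp del: of_nat_Suc)
qed

lemma measurable_rat_approx: "rat_approx n \<in> measurable borel (count_space UNIV)"
proof -
  have "(\<lambda>s. \<lfloor>real (Suc n) * s\<rfloor>) \<in> measurable borel (count_space UNIV)"
    by (rule measurable_compose[OF _ measurable_real_floor]) measurable
  from measurable_compose[OF this measurable_count_space, of "\<lambda>k. of_int k / of_nat (Suc n)"]
  show ?thesis by (simp add: rat_approx_def[abs_def])
qed

definition rat_lipschitz :: "(rat \<Rightarrow> 'a::metric_space) \<Rightarrow> bool" where
  "rat_lipschitz f \<longleftrightarrow> (\<forall>p q. dist (f p) (f q) \<le> \<bar>real_of_rat p - real_of_rat q\<bar>)"

text \<open>The value outside \<open>rat_lipschitz\<close> is chosen to make \<open>rat_ext\<close> a measurable function of \<open>f\<close>.\<close>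

definition rat_ext :: "(rat \<Rightarrow> 'a::metric_space) \<Rightarrow> real \<Rightarrow> 'a" where
  "rat_ext f s = (if rat_lipschitz f then lim (\<lambda>n. f (rat_approx n s)) else f 0)"

lemma rat_ext_tendsto:
  fixes f :: "rat \<Rightarrow> 'a::complete_space"
  assumes "rat_lipschitz f"
  shows "(\<lambda>n. f (rat_approx n s)) \<longlonglongrightarrow> rat_ext f s"
proof -
  have "Cauchy (\<lambda>n. real_of_rat (rat_approx n s))"
    using rat_approx_tendsto by (rule LIMSEQ_imp_Cauchy)
  then have "Cauchy (\<lambda>n. f (rat_approx n s))"
    unfolding Cauchy_def
  proof (elim all_forward imp_forward ex_forward)
    fix e :: real and m n
    assume "dist (real_of_rat (rat_approx m s)) (real_of_rat (rat_approx n s)) < e"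
    then show "dist (f (rat_approx m s)) (f (rat_approx n s)) < e"
      using assms le_less_trans unfolding rat_lipschitz_def dist_real_def by fast
  qed
  then have "convergent (\<lambda>n. f (rat_approx n s))" by (rule Cauchy_convergent)
  then show ?thesis using assms by (simp add: rat_ext_def convergent_LIMSEQ_iff)
qed

lemma rat_ext_lipschitz:
  fixes f :: "rat \<Rightarrow> 'a::complete_space"
  assumes "rat_lipschitz f"
  shows "dist (rat_ext f s) (rat_ext f t) \<le> \<bar>s - t\<bar>"
proof (rule LIMSEQ_le)
  show "(\<lambda>n. dist (f (rat_approx n s)) (f (rat_approx n t))) \<longlonglongrightarrow> dist (rat_ext f s) (rat_ext f t)"
    by (intro tendsto_dist rat_ext_tendsto assms)
  show "(\<lambda>n. \<bar>real_of_rat (rat_approx n s) - real_of_rat (rat_approx n t)\<bar>) \<longlonglongrightarrow> \<bar>s - t\<bar>"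
    by (intro tendsto_rabs tendsto_diff rat_approx_tendsto)
  show "\<exists>N. \<forall>n\<ge>N. dist (f (rat_approx n s)) (f (rat_approx n t))
      \<le> \<bar>real_of_rat (rat_approx n s) - real_of_rat (rat_approx n t)\<bar>"
    using assms by (simp add: rat_lipschitz_def)
qed

lemma lipschitz_continuous_on:
  assumes "\<And>s t :: real. dist (g s) (g t) \<le> \<bar>s - t\<bar>"
  shows "continuous_on A g"
  unfolding continuous_on_iff
proof (intro ballI allI impI)
  fix s and e :: real assume "e > 0"
  moreover have "dist (g t) (g s) < e" if "dist t s < e" for t
    using assms[of t s] that by (simp add: dist_real_def)
  ultimately show "\<exists>d>0. \<forall>t\<in>A. dist t s < d \<longrightarrow> dist (g t) (g s) < e"
    by (intro exI[of _ e]) simp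
qed

text \<open>No information is lost in passing from a 1-Lipschitz curve to its values at the
  rationals.\<close>

lemma rat_ext_restrict:
  fixes g :: "real \<Rightarrow> 'a::metric_space"
  assumes g: "\<And>s t. dist (g s) (g t) \<le> \<bar>s - t\<bar>"
  shows "rat_ext (\<lambda>q. g (real_of_rat q)) s = g s"
proof -
  have "continuous_on UNIV g" using g by (rule lipschitz_continuous_on)
  then have "(\<lambda>n. g (real_of_rat (rat_approx n s))) \<longlonglongrightarrow> g s"
    by (rule continuous_on_tendsto_compose[OF _ rat_approx_tendsto]) auto
  moreover have "rat_lipschitz (\<lambda>q. g (real_of_rat q))" using g by (simp add: rat_lipschitz_def)
  ultimately show ?thesis by (simp add: rat_ext_def limI)
qed

lemma rat_ext_of_rat:
  fixes f :: "rat \<Rightarrow> 'a::complete_space"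
  assumes "rat_lipschitz f"
  shows "rat_ext f (real_of_rat q) = f q"
proof -
  have "(\<lambda>n. dist (f (rat_approx n (real_of_rat q))) (f q)) \<longlonglongrightarrow> 0"
  proof (rule real_tendsto_sandwich[OF _ _ tendsto_const])
    show "(\<lambda>n. \<bar>real_of_rat (rat_approx n (real_of_rat q)) - real_of_rat q\<bar>) \<longlonglongrightarrow> 0"
      using tendsto_rabs[OF tendsto_diff[OF rat_approx_tendsto[of "real_of_rat q"] tendsto_const[of "real_of_rat q"]]] by simp
  qed (use assms in \<open>auto simp: rat_lipschitz_def\<close>)
  then have "(\<lambda>n. f (rat_approx n (real_of_rat q))) \<longlonglongrightarrow> f q" by (rule tendsto_dist_iff[THEN iffD2])
  then show ?thesis using LIMSEQ_unique[OF rat_ext_tendsto[OF assms]] by simp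
qed

lemma closed_rat_lipschitz: "closed {f :: rat \<Rightarrow> 'a::metric_space. rat_lipschitz f}"
  unfolding rat_lipschitz_def
  by (intro closed_Collect_all closed_Collect_le continuous_on_dist continuous_on_const
      continuous_on_product_coordinates)

text \<open>The map is a pointwise limit of evaluations at \<open>rat_approx n s\<close>. Each of
  these is measurable because the index takes countably many values; for functions that are not
  Lipschitz the approximants are constantly \<open>f 0\<close>.\<close>

lemma measurable_rat_ext:
  "(\<lambda>(f :: rat \<Rightarrow> 'a::polish_space, s). rat_ext f s) \<in> borel_measurable (borel \<Otimes>\<^sub>M borel)"
proof -
  have lip: "Measurable.pred borel (rat_lipschitz :: (rat \<Rightarrow> 'a) \<Rightarrow> bool)"
    using borel_closed[OF closed_rat_lipschitz[where 'a='a]] by (simp add: pred_def)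
  have [measurable]: "(\<lambda>f :: rat \<Rightarrow> 'a. f q) \<in> borel_measurable borel" for q
    by (intro borel_measurable_continuous_onI continuous_on_product_coordinates)
  show ?thesis
  proof (rule borel_measurable_LIMSEQ_metric)
    fix n
    note measurable_rat_approx[measurable]
    have "(\<lambda>p :: (rat \<Rightarrow> 'a) \<times> real. fst p (rat_approx n (snd p))) \<in> borel_measurable (borel \<Otimes>\<^sub>M borel)"
      by (rule measurable_compose_countable[of "\<lambda>q p. fst p q"]) measurable
    then show "(\<lambda>p :: (rat \<Rightarrow> 'a) \<times> real. if rat_lipschitz (fst p) then fst p (rat_approx n (snd p)) else fst p 0)
        \<in> borel_measurable (borel \<Otimes>\<^sub>M borel)"
      using lip by measurable
  next
    fix p :: "(rat \<Rightarrow> 'a) \<times> real"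
    show "(\<lambda>n. if rat_lipschitz (fst p) then fst p (rat_approx n (snd p)) else fst p 0)
        \<longlonglongrightarrow> (case p of (f, s) \<Rightarrow> rat_ext f s)"
      using rat_ext_tendsto[of "fst p" "snd p"]
      by (cases "rat_lipschitz (fst p)") (simp_all add: case_prod_beta rat_ext_def)
  qed
qed

section \<open>Lengths of curves and their computation from rational partitions\<close>

lemma sum_le_curve_length:
  assumes "t 0 = a" "t n = b" "\<And>i. i < n \<Longrightarrow> t i \<le> t (Suc i)"
  shows "(\<Sum>i<n. ennreal (dist (\<gamma> (t i)) (\<gamma> (t (Suc i))))) \<le> curve_length a b \<gamma>"
  unfolding curve_length_def by (rule SUP_upper2[of "(n, t)"]) (use assms in auto)

lemma curve_length_leI:
  assumes "\<And>n t. t 0 = a \<Longrightarrow> t n = b \<Longrightarrow> (\<And>i. i < n \<Longrightarrow> t i \<le> t (Suc i)) \<Longrightarrow>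
    (\<Sum>i<n. ennreal (dist (\<gamma> (t i)) (\<gamma> (t (Suc i))))) \<le> c"
  shows "curve_length a b \<gamma> \<le> c"
  unfolding curve_length_def by (rule SUP_least) (use assms in auto)

text \<open>A partition of [a, s] followed by the point \<open>t\<close> is a partition of [a, t].
  The inequality yields both monotonicity of the length and the Lipschitz property of arc-length
  curves.\<close>

lemma curve_length_add_dist_le:
  assumes "a \<le> s" "s \<le> t"
  shows "curve_length a s \<gamma> + ennreal (dist (\<gamma> s) (\<gamma> t)) \<le> curve_length a t \<gamma>"
proof -
  let ?d = "ennreal (dist (\<gamma> s) (\<gamma> t))" and ?c = "curve_length a t \<gamma>"
  have "(\<Sum>i<n. ennreal (dist (\<gamma> (p i)) (\<gamma> (p (Suc i))))) + ?d \<le> ?c"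
    if p: "p 0 = a" "p n = s" "\<And>i. i < n \<Longrightarrow> p i \<le> p (Suc i)" for n p
  proof -
    define p' where "p' = p(Suc n := t)"
    have "(\<Sum>i<Suc n. ennreal (dist (\<gamma> (p' i)) (\<gamma> (p' (Suc i))))) \<le> ?c"
      by (rule sum_le_curve_length) (use p assms in \<open>auto simp: p'_def less_Suc_eq\<close>)
    moreover have "(\<Sum>i<n. ennreal (dist (\<gamma> (p' i)) (\<gamma> (p' (Suc i))))) =
        (\<Sum>i<n. ennreal (dist (\<gamma> (p i)) (\<gamma> (p (Suc i)))))"
      by (rule sum.cong) (auto simp: p'_def)
    ultimately show ?thesis using p(2) by (simp add: p'_def)
  qed
  \<comment> \<open>The bound is moved through the supremum by subtracting \<open>?d\<close>.
    Subtraction in \<open>ennreal\<close> truncates at 0, so this separate bound is needed to add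
    \<open>?d\<close> back; it comes from the partition a, s, t.\<close>
  moreover have "?d \<le> ?c"
  proof -
    define p' where "p' = (\<lambda>i :: nat. if i = 0 then a else if i = 1 then s else t)"
    have "(\<Sum>i<2. ennreal (dist (\<gamma> (p' i)) (\<gamma> (p' (Suc i))))) \<le> ?c"
      by (rule sum_le_curve_length) (use assms in \<open>auto simp: p'_def\<close>)
    moreover have "?d \<le> (\<Sum>i<2. ennreal (dist (\<gamma> (p' i)) (\<gamma> (p' (Suc i)))))"
      by (simp add: p'_def numeral_2_eq_2)
    ultimately show ?thesis by (rule order_trans[rotated])
  qed
  ultimately have "curve_length a s \<gamma> \<le> ?c - ?d"
    by (intro curve_length_leI) (simp add: ennreal_le_minus_iff add.commute)
  then show ?thesis using \<open>?d \<le> ?c\<close> by (auto simp: ennreal_le_minus_iff)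
qed

text \<open>Partitions are finite lists and not functions on the naturals, so that there are only
  countably many of them and the supremum in \<open>rat_length\<close> is measurable.\<close>

definition rat_partitions :: "rat \<Rightarrow> (nat \<times> rat list) set" where
  "rat_partitions q =
    {(n, ts). length ts = Suc n \<and> ts ! 0 = 0 \<and> ts ! n = q \<and> (\<forall>i<n. ts ! i \<le> ts ! Suc i)}"

definition rat_length :: "(rat \<Rightarrow> 'a::metric_space) \<Rightarrow> rat \<Rightarrow> ennreal" where
  "rat_length f q =
    (SUP p\<in>rat_partitions q. \<Sum>i<fst p. ennreal (dist (f (snd p ! i)) (f (snd p ! Suc i))))"

lemma measurable_rat_length:
  "(\<lambda>f :: rat \<Rightarrow> 'a::{metric_space, second_countable_topology}. rat_length f q) \<in> borel_measurable borel"
proof -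
  have [measurable]: "(\<lambda>f :: rat \<Rightarrow> 'a. f r) \<in> borel_measurable borel" for r
    by (intro borel_measurable_continuous_onI continuous_on_product_coordinates)
  show ?thesis
    unfolding rat_length_def by measurable
qed

lemma rat_length_le:
  fixes f :: "rat \<Rightarrow> 'a::complete_space"
  assumes "rat_lipschitz f"
  shows "rat_length f q \<le> curve_length 0 (real_of_rat q) (rat_ext f)"
  unfolding rat_length_def
proof (rule SUP_least)
  fix p assume p: "p \<in> rat_partitions q"
  have "(\<Sum>i<fst p. ennreal (dist (rat_ext f (real_of_rat (snd p ! i))) (rat_ext f (real_of_rat (snd p ! Suc i)))))
      \<le> curve_length 0 (real_of_rat q) (rat_ext f)"
    by (rule sum_le_curve_length[of "\<lambda>i. real_of_rat (snd p ! i)"])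
      (use p in \<open>auto simp: rat_partitions_def of_rat_less_eq\<close>)
  then show "(\<Sum>i<fst p. ennreal (dist (f (snd p ! i)) (f (snd p ! Suc i))))
      \<le> curve_length 0 (real_of_rat q) (rat_ext f)"
    by (simp add: rat_ext_of_rat[OF assms])
qed

text \<open>Every partition is a limit of rational partitions of the same size, and by continuity of
  \<open>g\<close> the corresponding sums converge.\<close>

lemma curve_length_le_rat_length:
  fixes g :: "real \<Rightarrow> 'a::metric_space"
  assumes g: "continuous_on UNIV g" and "q > 0"
  shows "curve_length 0 (real_of_rat q) g \<le> rat_length (\<lambda>r. g (real_of_rat r)) q"
proof (rule curve_length_leI)
  fix n :: nat and t :: "nat \<Rightarrow> real"
  assume t: "t 0 = 0" "t n = real_of_rat q" "\<And>i. i < n \<Longrightarrow> t i \<le> t (Suc i)"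
  have r: "real_of_rat q > 0" using \<open>q > 0\<close> by simp
  \<comment> \<open>The points are scaled to [0, 1] before rounding and scaled back afterwards,
    since the rounding is exact at 0 and 1 but not at an arbitrary \<open>q\<close>.\<close>
  define c where "c M i = q * rat_approx M (t i / real_of_rat q)" for M i
  have c_lim: "(\<lambda>M. real_of_rat (c M i)) \<longlonglongrightarrow> t i" for i
    using tendsto_mult[OF tendsto_const rat_approx_tendsto, of "real_of_rat q" "t i / real_of_rat q"] r
    by (simp add: c_def of_rat_mult)
  have "(\<lambda>M. \<Sum>i<n. dist (g (real_of_rat (c M i))) (g (real_of_rat (c M (Suc i)))))
      \<longlonglongrightarrow> (\<Sum>i<n. dist (g (t i)) (g (t (Suc i))))"
    by (intro tendsto_sum tendsto_dist continuous_on_tendsto_compose[OF g c_lim]) auto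
  then have "(\<lambda>M. ennreal (\<Sum>i<n. dist (g (real_of_rat (c M i))) (g (real_of_rat (c M (Suc i))))))
      \<longlonglongrightarrow> ennreal (\<Sum>i<n. dist (g (t i)) (g (t (Suc i))))"
    by (rule tendsto_ennrealI)
  moreover have "ennreal (\<Sum>i<n. dist (g (real_of_rat (c M i))) (g (real_of_rat (c M (Suc i)))))
      \<le> rat_length (\<lambda>r. g (real_of_rat r)) q" for M
  proof -
    define ts where "ts = map (c M) [0..<Suc n]"
    have nth: "ts ! i = c M i" if "i \<le> n" for i
      using that by (simp add: ts_def nth_append less_Suc_eq_le del: upt_Suc)
    have "(n, ts) \<in> rat_partitions q"
      unfolding rat_partitions_def mem_Collect_eq prod.case
    proof (intro conjI allI impI)
      show "length ts = Suc n" by (simp add: ts_def)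
      show "ts ! 0 = 0" by (simp add: nth c_def t rat_approx_0)
      show "ts ! n = q" using r by (simp add: nth c_def t rat_approx_1)
      fix i assume "i < n"
      then show "ts ! i \<le> ts ! Suc i"
        using t(3)[of i] r \<open>q > 0\<close>
        by (auto simp: nth c_def intro!: mult_left_mono rat_approx_mono divide_right_mono)
    qed
    then have "(\<Sum>i<n. ennreal (dist (g (real_of_rat (ts ! i))) (g (real_of_rat (ts ! Suc i)))))
        \<le> rat_length (\<lambda>r. g (real_of_rat r)) q"
      unfolding rat_length_def by (rule SUP_upper2) simp
    moreover have "(\<Sum>i<n. ennreal (dist (g (real_of_rat (ts ! i))) (g (real_of_rat (ts ! Suc i))))) =
        ennreal (\<Sum>i<n. dist (g (real_of_rat (c M i))) (g (real_of_rat (c M (Suc i)))))"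
      by (subst sum_ennreal[symmetric]) (auto simp: nth intro!: sum.cong)
    ultimately show ?thesis by simp
  qed
  ultimately have "ennreal (\<Sum>i<n. dist (g (t i)) (g (t (Suc i)))) \<le> rat_length (\<lambda>r. g (real_of_rat r)) q"
    by (intro LIMSEQ_le_const2) auto
  then show "(\<Sum>i<n. ennreal (dist (g (t i)) (g (t (Suc i))))) \<le> rat_length (\<lambda>r. g (real_of_rat r)) q"
    by (simp add: sum_ennreal)
qed

lemma lipschitz_curve_length_le:
  assumes "\<And>s t. dist (g s) (g t) \<le> \<bar>s - t\<bar>"
  shows "curve_length a b g \<le> ennreal (b - a)"
proof (rule curve_length_leI)
  fix n :: nat and t :: "nat \<Rightarrow> real"
  assume t: "t 0 = a" "t n = b" "\<And>i. i < n \<Longrightarrow> t i \<le> t (Suc i)"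
  have "(\<Sum>i<n. ennreal (dist (g (t i)) (g (t (Suc i))))) \<le> (\<Sum>i<n. ennreal (t (Suc i) - t i))"
  proof (intro sum_mono ennreal_leI)
    fix i assume "i \<in> {..<n}"
    then show "dist (g (t i)) (g (t (Suc i))) \<le> t (Suc i) - t i"
      using t(3)[of i] assms[of "t i" "t (Suc i)"] by simp
  qed
  also have "\<dots> = ennreal (\<Sum>i<n. t (Suc i) - t i)"
    by (rule sum_ennreal) (use t(3) in simp)
  also have "\<dots> = ennreal (b - a)"
    by (simp only: sum_lessThan_telescope t(1,2))
  finally show "(\<Sum>i<n. ennreal (dist (g (t i)) (g (t (Suc i))))) \<le> ennreal (b - a)" .
qed

text \<open>The Lipschitz bound gives length at most \<open>s\<close>. For the reverse, the length
  up to \<open>s\<close> is at least the length up to any rational q in (0, s), which is at least q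
  by hypothesis.\<close>

lemma arc_length_curve_rat_ext:
  fixes f :: "rat \<Rightarrow> 'a::complete_space"
  assumes f: "rat_lipschitz f" and "0 \<le> l"
    and len: "\<And>q. 0 < q \<Longrightarrow> real_of_rat q \<le> l \<Longrightarrow> ennreal (real_of_rat q) \<le> rat_length f q"
  shows "arc_length_curve l (rat_ext f)"
proof -
  have eq: "curve_length 0 s (rat_ext f) = ennreal s" if s: "s \<in> {0..l}" for s
  proof (rule antisym)
    show "curve_length 0 s (rat_ext f) \<le> ennreal s"
      using lipschitz_curve_length_le[of "rat_ext f" 0 s, OF rat_ext_lipschitz[OF f]] by simp
    show "ennreal s \<le> curve_length 0 s (rat_ext f)"
    proof (rule dense_le)
      fix y assume y: "y < ennreal s"
      then obtain r where r: "y = ennreal r" "0 \<le> r" by (cases y) auto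
      then have "r < s" using y by (simp add: ennreal_less_iff)
      then obtain q where q: "r < real_of_rat q" "real_of_rat q < s" using of_rat_dense[OF \<open>r < s\<close>] by blast
      then have q0: "0 < real_of_rat q" using r(2) by linarith
      have "y \<le> ennreal (real_of_rat q)" using q r by (simp add: ennreal_leI)
      also have "\<dots> \<le> rat_length f q" using q q0 s by (intro len) auto
      also have "\<dots> \<le> curve_length 0 (real_of_rat q) (rat_ext f)" using f by (rule rat_length_le)
      also have "\<dots> \<le> curve_length 0 s (rat_ext f)"
        using q q0 by (intro order_trans[OF _ curve_length_add_dist_le[where s = "real_of_rat q"]]) simp_all
      finally show "y \<le> curve_length 0 s (rat_ext f)" .
    qed
  qed
  then show ?thesis
    using \<open>0 \<le> l\<close> lipschitz_continuous_on[of "rat_ext f", OF rat_ext_lipschitz[OF f]]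
    by (simp add: arc_length_curve_def rectifiable_curve_def is_curve_def)
qed

text \<open>The distance of two points is at most the difference of the lengths of the initial
  pieces, and for arc length these are the parameters themselves.\<close>

lemma arc_length_curve_lipschitz:
  assumes "arc_length_curve l \<gamma>" "s \<in> {0..l}" "t \<in> {0..l}"
  shows "dist (\<gamma> s) (\<gamma> t) \<le> \<bar>s - t\<bar>"
proof -
  have *: "dist (\<gamma> s) (\<gamma> t) \<le> t - s" if "s \<in> {0..l}" "t \<in> {0..l}" "s \<le> t" for s t
  proof -
    have "ennreal s + ennreal (dist (\<gamma> s) (\<gamma> t)) \<le> ennreal t"
      using curve_length_add_dist_le[of 0 s t \<gamma>] assms(1) that by (simp add: arc_length_curve_def)
    then have "ennreal (s + dist (\<gamma> s) (\<gamma> t)) \<le> ennreal t"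
      using that by (simp add: ennreal_plus[symmetric] del: ennreal_plus)
    then show ?thesis using that by (simp add: ennreal_le_iff del: ennreal_plus)
  qed
  show ?thesis
  proof (cases "s \<le> t")
    case True
    then show ?thesis using *[of s t] assms by simp
  next
    case False
    then show ?thesis using *[of t s] assms by (simp add: dist_commute)
  qed
qed

text \<open>Replaces curves by rational data: the condition of arc length becomes countably many
  inequalities between \<open>q\<close> and \<open>rat_length f q\<close>, whose reverse already
  follows from the Lipschitz condition.\<close>

lemma u_fun_less_iff:
  fixes U :: "'a::complete_space set"
  shows "u_fun U \<rho> x < a \<longleftrightarrow>
    (\<exists>f l. rat_lipschitz f \<and> 0 \<le> l \<and>
      (\<forall>q. 0 < q \<longrightarrow> real_of_rat q \<le> l \<longrightarrow> ennreal (real_of_rat q) \<le> rat_length f q) \<and>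
      curve_integral \<rho> l (rat_ext f) < a \<and> rat_ext f l \<in> - U \<and> f 0 = x)"
  (is "?L \<longleftrightarrow> (\<exists>f l. ?R f l)")
proof
  assume ?L
  then obtain l \<gamma> where \<gamma>: "arc_length_curve l \<gamma>" "\<gamma> 0 = x" "\<gamma> l \<in> - U" "curve_integral \<rho> l \<gamma> < a"
    unfolding u_fun_def curves_leaving_def INF_less_iff by auto
  have "0 \<le> l" using \<gamma>(1) by (simp add: arc_length_curve_def rectifiable_curve_def is_curve_def)
  \<comment> \<open>Clamping to [0, l] extends the curve by constants to the whole line. It does not
    increase distances, so the extension is again 1-Lipschitz.\<close>
  define c where "c s = max 0 (min l s)" for s
  define g where "g s = \<gamma> (c s)" for s
  have c: "c s \<in> {0..l}" "\<bar>c s - c t\<bar> \<le> \<bar>s - t\<bar>" for s t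
    using \<open>0 \<le> l\<close> by (auto simp: c_def)
  have c_id: "c s = s" if "s \<in> {0..l}" for s using that by (simp add: c_def)
  have g: "dist (g s) (g t) \<le> \<bar>s - t\<bar>" for s t
    using arc_length_curve_lipschitz[OF \<gamma>(1) c(1) c(1), of s t] c(2)[of s t] by (simp add: g_def)
  define f where "f q = g (real_of_rat q)" for q
  have ext: "rat_ext f s = g s" for s
    unfolding f_def using g by (rule rat_ext_restrict)
  have "?R f l"
  proof (intro conjI allI impI)
    show "0 \<le> l" by fact
    show "rat_lipschitz f" using g by (simp add: rat_lipschitz_def f_def)
    show "f 0 = x" using \<gamma>(2) \<open>0 \<le> l\<close> by (simp add: f_def g_def c_id)
    show "rat_ext f l \<in> - U" unfolding ext using \<gamma>(3) \<open>0 \<le> l\<close> by (simp add: g_def c_id)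
    have "curve_integral \<rho> l (rat_ext f) = curve_integral \<rho> l \<gamma>"
      unfolding curve_integral_def ext
      by (intro nn_integral_cong) (simp add: g_def c_id indicator_def)
    then show "curve_integral \<rho> l (rat_ext f) < a" using \<gamma>(4) by simp
  next
    fix q :: rat assume q: "0 < q" "real_of_rat q \<le> l"
    have "ennreal (real_of_rat q) = curve_length 0 (real_of_rat q) \<gamma>"
      using \<gamma>(1) q by (simp add: arc_length_curve_def)
    \<comment> \<open>All points of a partition of [0, q] lie in [0, l], where \<gamma> and
      \<open>g\<close> agree.\<close>
    also have "\<dots> \<le> curve_length 0 (real_of_rat q) g"
    proof (rule curve_length_leI)
      fix n :: nat and t :: "nat \<Rightarrow> real"
      assume t: "t 0 = 0" "t n = real_of_rat q" "\<And>i. i < n \<Longrightarrow> t i \<le> t (Suc i)"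
      have mono: "i \<le> j \<Longrightarrow> j \<le> n \<Longrightarrow> t i \<le> t j" for i j
      proof (induction j)
        case (Suc j)
        then show ?case using t(3)[of j] by (cases "i = Suc j") auto
      qed simp
      have "t i \<in> {0..l}" if "i \<le> n" for i
        using mono[of 0 i] mono[of i n] that t(1,2) q(2) by simp
      then have "(\<Sum>i<n. ennreal (dist (\<gamma> (t i)) (\<gamma> (t (Suc i))))) =
          (\<Sum>i<n. ennreal (dist (g (t i)) (g (t (Suc i)))))"
        by (intro sum.cong) (auto simp: g_def c_id)
      also have "\<dots> \<le> curve_length 0 (real_of_rat q) g" using t by (rule sum_le_curve_length)
      finally show "(\<Sum>i<n. ennreal (dist (\<gamma> (t i)) (\<gamma> (t (Suc i))))) \<le> curve_length 0 (real_of_rat q) g" .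
    qed
    also have "\<dots> \<le> rat_length f q"
      unfolding f_def using lipschitz_continuous_on[OF g] q(1) by (rule curve_length_le_rat_length)
    finally show "ennreal (real_of_rat q) \<le> rat_length f q" .
  qed
  then show "\<exists>f l. ?R f l" by (rule exI[of "\<lambda>f. \<exists>l. ?R f l" f, OF exI[of "?R f" l]])
next
  assume "\<exists>f l. ?R f l"
  then obtain f l where R: "?R f l" by (elim exE)
  then have "arc_length_curve l (rat_ext f)" by (intro arc_length_curve_rat_ext) simp_all
  moreover have "rat_ext f 0 = x"
    using rat_ext_of_rat[of f 0] R by simp
  ultimately have "(l, rat_ext f) \<in> curves_leaving U x" using R by (simp add: curves_leaving_def)
  then have "u_fun U \<rho> x \<le> curve_integral \<rho> l (rat_ext f)"
    unfolding u_fun_def by (rule INF_lower2) simp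
  with R show ?L by (simp add: le_less_trans)
qed

section \<open>Sublevel sets\<close>

lemma measurable_curve_integral_rat_ext:
  fixes \<rho> :: "'a::polish_space \<Rightarrow> ennreal"
  assumes [measurable]: "\<rho> \<in> borel_measurable borel"
  shows "(\<lambda>(f, l). curve_integral \<rho> l (rat_ext f)) \<in> borel_measurable borel"
proof -
  have [measurable]: "(\<lambda>p :: ((rat \<Rightarrow> 'a) \<times> real) \<times> real. rat_ext (fst (fst p)) (snd p))
      \<in> borel_measurable ((borel \<Otimes>\<^sub>M borel) \<Otimes>\<^sub>M lborel)"
    using measurable_compose[OF _ measurable_rat_ext[where 'a = 'a],
        of "\<lambda>p. (fst (fst p), snd p)" "(borel \<Otimes>\<^sub>M borel) \<Otimes>\<^sub>M lborel"]
    by simp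
  have "(\<lambda>p. \<integral>\<^sup>+s. \<rho> (rat_ext (fst p) s) * indicator {0..snd p} s \<partial>lborel)
      \<in> borel_measurable ((borel :: (rat \<Rightarrow> 'a) measure) \<Otimes>\<^sub>M borel)"
    \<comment> \<open>The interval depends on the parameter \<open>l\<close>, so its indicator is
      unfolded to a condition that is jointly measurable in \<open>l\<close> and
      \<open>s\<close>.\<close>
    by (rule lborel.borel_measurable_nn_integral) (unfold indicator_def atLeastAtMost_iff, measurable)
  then show ?thesis
    by (simp add: curve_integral_def case_prod_beta' borel_prod)
qed

text \<open>The two end points are treated differently. The final point is only a Borel function of
  (f, l), which is enough for a preimage; the initial point is the coordinate \<open>f 0\<close>,
  hence continuous, as the image requires.\<close>

lemma suslin_set_u_fun_less:
  fixes U :: "'a::polish_space set"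
  assumes U: "coanalytic_set U" and \<rho>: "\<rho> \<in> borel_measurable borel"
  shows "suslin_set {x. u_fun U \<rho> x < a}"
proof -
  define B where "B = {p :: (rat \<Rightarrow> 'a) \<times> real. rat_lipschitz (fst p) \<and> 0 \<le> snd p \<and>
    (\<forall>q. 0 < q \<longrightarrow> real_of_rat q \<le> snd p \<longrightarrow> ennreal (real_of_rat q) \<le> rat_length (fst p) q) \<and>
    curve_integral \<rho> (snd p) (rat_ext (fst p)) < a}"
  define e where "e = (\<lambda>p :: (rat \<Rightarrow> 'a) \<times> real. rat_ext (fst p) (snd p))"
  have fst_m [measurable]: "fst \<in> borel_measurable (borel :: ((rat \<Rightarrow> 'a) \<times> real) measure)"
    and snd_m [measurable]: "snd \<in> borel_measurable (borel :: ((rat \<Rightarrow> 'a) \<times> real) measure)"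
    by (intro borel_measurable_continuous_onI continuous_on_fst continuous_on_snd continuous_on_id)+
  have [measurable]: "Measurable.pred borel (rat_lipschitz :: (rat \<Rightarrow> 'a) \<Rightarrow> bool)"
    using borel_closed[OF closed_rat_lipschitz[where 'a='a]] by (simp add: pred_def)
  have [measurable]: "(\<lambda>p :: (rat \<Rightarrow> 'a) \<times> real. rat_length (fst p) q) \<in> borel_measurable borel" for q
    using fst_m measurable_rat_length by (rule measurable_compose)
  have [measurable]: "(\<lambda>p :: (rat \<Rightarrow> 'a) \<times> real. curve_integral \<rho> (snd p) (rat_ext (fst p)))
      \<in> borel_measurable borel"
    using measurable_curve_integral_rat_ext[OF \<rho>] by (simp add: case_prod_beta')
  have "Measurable.pred borel (\<lambda>p. p \<in> B)"
    unfolding B_def mem_Collect_eq by measurable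
  then have "suslin_set B"
    by (intro suslin_set_borel) (simp add: pred_def)
  moreover have "suslin_set (e -` (- U))"
  proof (rule suslin_set_vimage)
    show "suslin_set (- U)"
      using U analytic_set_imp_suslin_set by (simp add: coanalytic_set_def)
    show "e \<in> borel_measurable borel"
      using measurable_rat_ext[where 'a='a] by (simp add: e_def case_prod_beta' borel_prod)
  qed
  ultimately have "suslin_set (B \<inter> e -` (- U))" by (rule suslin_set_Int)
  moreover have "continuous_on UNIV (\<lambda>p :: (rat \<Rightarrow> 'a) \<times> real. fst p 0)"
    by (rule continuous_on_product_then_coordinatewise[OF continuous_on_fst[OF continuous_on_id]])
  ultimately have "suslin_set ((\<lambda>p. fst p 0) ` (B \<inter> e -` (- U)))"
    by (rule suslin_set_image)
  also have "(\<lambda>p. fst p 0) ` (B \<inter> e -` (- U)) = {x. u_fun U \<rho> x < a}"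
  proof (intro set_eqI)
    fix x
    have "x \<in> (\<lambda>p. fst p 0) ` (B \<inter> e -` (- U)) \<longleftrightarrow> (\<exists>f l. (f, l) \<in> B \<and> e (f, l) \<in> - U \<and> f 0 = x)"
    proof
      assume "x \<in> (\<lambda>p. fst p 0) ` (B \<inter> e -` (- U))"
      then obtain p where "x = fst p 0" "p \<in> B \<inter> e -` (- U)" by (elim imageE)
      then show "\<exists>f l. (f, l) \<in> B \<and> e (f, l) \<in> - U \<and> f 0 = x"
        by (intro exI[of _ "fst p"] exI[of _ "snd p"]) simp
    next
      assume "\<exists>f l. (f, l) \<in> B \<and> e (f, l) \<in> - U \<and> f 0 = x"
      then obtain f l where "(f, l) \<in> B" "e (f, l) \<in> - U" "f 0 = x" by (elim exE conjE)
      then show "x \<in> (\<lambda>p. fst p 0) ` (B \<inter> e -` (- U))"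
        by (intro image_eqI[of _ _ "(f, l)"]) simp_all
    qed
    then show "x \<in> (\<lambda>p. fst p 0) ` (B \<inter> e -` (- U)) \<longleftrightarrow> x \<in> {x. u_fun U \<rho> x < a}"
      by (simp only: u_fun_less_iff B_def e_def mem_Collect_eq fst_conv snd_conv conj_assoc)
  qed
  finally show ?thesis .
qed

theorem proposition1p5:
  fixes \<mu> :: "'a::polish_space measure" and U :: "'a set" and \<rho> :: "'a \<Rightarrow> ennreal"
  assumes "space \<mu> = UNIV"
    and "sets borel \<subseteq> sets \<mu>"
    and "complete_measure \<mu>"
    and "\<And>x r. emeasure \<mu> (ball x r) < \<infinity>"
    and "coanalytic_set U"
    and "\<rho> \<in> borel_measurable borel"
  shows "u_fun U \<rho> \<in> borel_measurable \<mu>"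
proof (rule borel_measurableI_less)
  fix a
  \<comment> \<open>The balls of integer radius about one fixed point have finite measure and cover
    the space.\<close>
  have "sigma_finite_measure \<mu>"
  proof
    fix x :: 'a
    have "range (\<lambda>n. ball x (real n)) \<subseteq> sets \<mu>"
      using assms(2) borel_open[OF open_ball] by blast
    moreover have "(\<Union>n. ball x (real n)) = space \<mu>"
      using reals_Archimedean2 by (auto simp: assms(1))
    ultimately show "\<exists>A. countable A \<and> A \<subseteq> sets \<mu> \<and> \<Union> A = space \<mu> \<and> (\<forall>a\<in>A. emeasure \<mu> a \<noteq> \<infinity>)"
      using assms(4) by (intro exI[of _ "range (\<lambda>n. ball x (real n))"]) (auto simp: less_top[symmetric])
  qed
  then have "{x. u_fun U \<rho> x < a} \<in> sets \<mu>"
    using assms by (intro suslin_set_measurable suslin_set_u_fun_less)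
  then show "{x \<in> space \<mu>. u_fun U \<rho> x < a} \<in> sets \<mu>"
    by (simp add: assms(1))
qed

end
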